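(* Let $\sigma>0$. Formally, with respect to the $L^2(\Omega;\mathbb R^N)$-metric, the proximal map of $G^*$ is pointwise radial. For $q\in L^2(\Omega;\mathbb R^N)$, $$\operatorname{prox}_{\sigma G^*}(q)(x)=\begin{cases}0,&q(x)=0,\\ \rho_\sigma(x,|q(x)|)\dfrac{q(x)}{|q(x)|},&q(x)\ne0,\end{cases}$$ where, for $r\ge0$, $$\rho_\sigma(x,r)=\begin{cases}r,&0\le r\le\alpha,\\ \alpha,&\alpha<r\le\alpha+\sigma\kappa(x),\\ r-\sigma\kappa(x),&\alpha+\sigma\kappa(x)<r\le\alpha(1+\gamma)+\sigma\kappa(x),\\ r-\alpha\gamma\,\operatorname{W}\!\left(\dfrac{\sigma\kappa(x)}{\alpha\gamma}\exp\!\left(\dfrac{r/\alpha-1-\gamma}{\gamma}\right)\right),&r>\alpha(1+\gamma)+\sigma\kappa(x).\end{cases}$$ Here $\operatorname{W}$ denotes the principal branch of the Lambert $W$-function.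
   Context: $\Omega\subset\mathbb R^N$ is a bounded Lipschitz domain, $\alpha>0$ and $\gamma>0$ are fixed, and $\kappa\in L^\infty(\Omega)$ is fixed with $0<\kappa_-\le\kappa(x)\le\kappa_+<\infty$ for a.e. $x\in\Omega$. With $\log^+r:=\max\{0,\log r\}$ for $r>0$ and $\log^+0:=0$, define $$\varphi_\gamma(x,t):=\alpha t\Bigl(1+\gamma\log^+\frac{t}{\kappa(x)}\Bigr)\ (t\ge0),\qquad \varphi_\gamma^*(x,s):=\sup_{t\ge0}\{st-\varphi_\gamma(x,t)\}\ (s\in\mathbb R).$$ Let $G(v):=\int_\Omega\varphi_\gamma(x,|v|)\,dx$ for vector fields $v$ on $\Omega$ with values in $\mathbb R^N$. Its conjugate is, formally, $$G^*(p)=\int_\Omega\varphi_\gamma^*(x,|p(x)|)\,dx.$$ The statement is a formal one: the proximal map of $G^*$ with respect to the $L^2(\Omega;\mathbb R^N)$-metric is understood through the formal $L^2$-proximal problem $$\operatorname{prox}_{\sigma G^*}(q)=\operatorname*{arg\,min}_{p}\int_\Omega\Bigl[\frac1{2\sigma}|p(x)-q(x)|^2+\varphi_\gamma^*(x,|p(x)|)\Bigr]\,dx.$$ *)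

theory Defs
  imports "HOL-Analysis.Analysis"
begin

(* Near each boundary point the set is the strict subgraph, in some unit direction e, of a
   Lipschitz function g on the hyperplane orthogonal to e; there the boundary is then the
   graph of g. *)
definition bounded_lipschitz_domain :: "('a::euclidean_space) set \<Rightarrow> bool" where
  "bounded_lipschitz_domain \<Omega> \<longleftrightarrow>
     open \<Omega> \<and> connected \<Omega> \<and> \<Omega> \<noteq> {} \<and> bounded \<Omega> \<and>
     (\<forall>z\<in>frontier \<Omega>. \<exists>U e L (g :: 'a \<Rightarrow> real).
        open U \<and> z \<in> U \<and> norm e = 1 \<and> L-lipschitz_on {y. y \<bullet> e = 0} g \<and>
        \<Omega> \<inter> U = {y \<in> U. y \<bullet> e < g (y - (y \<bullet> e) *\<^sub>R e)})"

definition log_plus :: "real \<Rightarrow> real" where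
  "log_plus r = (if r > 0 then max 0 (ln r) else 0)"

definition phi :: "real \<Rightarrow> real \<Rightarrow> ('a \<Rightarrow> real) \<Rightarrow> 'a \<Rightarrow> real \<Rightarrow> real" where
  "phi \<alpha> \<gamma> \<kappa> x t = \<alpha> * t * (1 + \<gamma> * log_plus (t / \<kappa> x))"

(* The supremum is taken in the extended reals, so that it is meaningful before its
   finiteness is known. *)
definition phi_star :: "real \<Rightarrow> real \<Rightarrow> ('a \<Rightarrow> real) \<Rightarrow> 'a \<Rightarrow> real \<Rightarrow> ereal" where
  "phi_star \<alpha> \<gamma> \<kappa> x s = (SUP t\<in>{0..}. ereal (s * t - phi \<alpha> \<gamma> \<kappa> x t))"

definition L2_fields :: "('a::euclidean_space) set \<Rightarrow> ('a \<Rightarrow> 'a) set" where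
  "L2_fields \<Omega> = {v \<in> borel_measurable (lebesgue_on \<Omega>).
                     integrable (lebesgue_on \<Omega>) (\<lambda>x. (norm (v x))\<^sup>2)}"

(* The integrand is nonnegative (t = 0 contributes 0 to the supremum in phi_star), so
   e2ennreal truncates nothing and the value in [0, \<infinity>] is always defined. *)
definition prox_objective ::
    "real \<Rightarrow> real \<Rightarrow> ('a \<Rightarrow> real) \<Rightarrow> ('a::euclidean_space) set \<Rightarrow> real \<Rightarrow> ('a \<Rightarrow> 'a) \<Rightarrow> ('a \<Rightarrow> 'a) \<Rightarrow> ennreal" where
  "prox_objective \<alpha> \<gamma> \<kappa> \<Omega> \<sigma> q p =
     (\<integral>\<^sup>+ x. e2ennreal (ereal (1 / (2 * \<sigma>) * (norm (p x - q x))\<^sup>2)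
               + phi_star \<alpha> \<gamma> \<kappa> x (norm (p x))) \<partial>lebesgue_on \<Omega>)"

(* The set of all minimisers over square-integrable fields. Its elements are functions, not
   classes modulo null sets, so it is a singleton only up to equality almost everywhere. *)
definition prox_G_star ::
    "real \<Rightarrow> real \<Rightarrow> ('a \<Rightarrow> real) \<Rightarrow> ('a::euclidean_space) set \<Rightarrow> real \<Rightarrow> ('a \<Rightarrow> 'a) \<Rightarrow> ('a \<Rightarrow> 'a) set" where
  "prox_G_star \<alpha> \<gamma> \<kappa> \<Omega> \<sigma> q =
     {p \<in> L2_fields \<Omega>. \<forall>p'\<in>L2_fields \<Omega>.
        prox_objective \<alpha> \<gamma> \<kappa> \<Omega> \<sigma> q p \<le> prox_objective \<alpha> \<gamma> \<kappa> \<Omega> \<sigma> q p'}"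

(* Principal branch, on [-1/e, \<infinity>). *)
definition lambert_W :: "real \<Rightarrow> real" where
  "lambert_W y = (THE w. w \<ge> -1 \<and> w * exp w = y)"

definition rho :: "real \<Rightarrow> real \<Rightarrow> ('a \<Rightarrow> real) \<Rightarrow> real \<Rightarrow> 'a \<Rightarrow> real \<Rightarrow> real" where
  "rho \<alpha> \<gamma> \<kappa> \<sigma> x r =
     (if r \<le> \<alpha> then r
      else if r \<le> \<alpha> + \<sigma> * \<kappa> x then \<alpha>
      else if r \<le> \<alpha> * (1 + \<gamma>) + \<sigma> * \<kappa> x then r - \<sigma> * \<kappa> x
      else r - \<alpha> * \<gamma> * lambert_W (\<sigma> * \<kappa> x / (\<alpha> * \<gamma>) * exp ((r / \<alpha> - 1 - \<gamma>) / \<gamma>)))"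

end

theory Submission
  imports Defs
begin

text \<open>Everything is pointwise. Writing \<open>\<rho> = rho \<dots> r\<close> and \<open>t = (r - \<rho>) / \<sigma>\<close>, the four
  branches of \<open>rho\<close> say exactly that \<open>\<rho>\<close> is a subgradient of \<open>\<phi>\<close> at \<open>t\<close>, so that the supremum
  defining \<open>\<phi>\<^sup>*(\<rho>)\<close> is attained at \<open>t\<close>. Testing \<open>\<phi>\<^sup>*(norm p)\<close> with the same \<open>t\<close> shows that the
  integrand at an arbitrary \<open>p\<close> exceeds the one at the radial candidate \<open>P\<close> by at least
  \<open>(norm (p - P))\<^sup>2 / (2\<sigma>)\<close>. Minimality follows by integration, and uniqueness because the
  minimal value is finite (compare with \<open>p = 0\<close>).\<close>

subsection \<open>The principal branch of the Lambert function\<close>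

text \<open>The derivative \<open>(1 + x) * exp x\<close> is positive only beyond -1 and vanishes
  there, hence the derivative criterion on the open interval.\<close>

lemma mult_exp_strict_mono:
  fixes v w :: real
  assumes "-1 \<le> v" "v < w"
  shows "v * exp v < w * exp w"
proof (rule DERIV_pos_imp_increasing_open[OF assms(2)])
  show "\<exists>y. ((\<lambda>x. x * exp x) has_real_derivative y) (at x) \<and> y > 0" if "v < x" "x < w" for x
    using that assms
    by (intro exI[of _ "(1 + x) * exp x"] conjI mult_pos_pos)
       (auto intro!: derivative_eq_intros simp: algebra_simps)
  show "continuous_on {v..w} (\<lambda>x. x * exp x)"
    by (intro continuous_intros)
qed

lemma lambert_W_mult_exp:
  assumes "-1 \<le> w"
  shows "lambert_W (w * exp w) = w"
  unfolding lambert_W_def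
proof (rule the_equality)
  show "v = w" if "-1 \<le> v \<and> v * exp v = w * exp w" for v
    using that assms mult_exp_strict_mono[of v w] mult_exp_strict_mono[of w v]
    by (cases v w rule: linorder_cases) auto
qed (use assms in auto)

lemma lambert_W:
  assumes "- exp (-1) \<le> y"
  shows "-1 \<le> lambert_W y" "lambert_W y * exp (lambert_W y) = y"
proof -
  \<comment> \<open>Right endpoint for the intermediate value theorem: 0 if y is negative, otherwise
    y itself, since exp y is at least 1. At the left endpoint -1 the function equals
    \<open>- exp (-1)\<close>.\<close>
  have "y \<le> max 0 y * exp (max 0 y)"
    using mult_left_mono[of 1 "exp y" y] by (auto simp: max_def)
  then obtain w where "-1 \<le> w" "w * exp w = y"
    using IVT'[of "\<lambda>x. x * exp x" "-1" y "max 0 y"] assms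
    by (force intro!: continuous_intros)
  then show "-1 \<le> lambert_W y" "lambert_W y * exp (lambert_W y) = y"
    using lambert_W_mult_exp[of w] by auto
qed

lemma lambert_W_mono:
  assumes "- exp (-1) \<le> y" "y \<le> z"
  shows "lambert_W y \<le> lambert_W z"
  using mult_exp_strict_mono[of "lambert_W z" "lambert_W y"] lambert_W[of y] lambert_W[of z] assms
  by (force simp: not_le[symmetric])

lemma borel_measurable_lambert_W [measurable]: "lambert_W \<in> borel_measurable borel"
proof -
  \<comment> \<open>Below \<open>-1/e\<close> the description in \<open>lambert_W\<close> is empty, and \<open>lambert_W\<close> is a junk constant.\<close>
  have "lambert_W y = (THE w::real. False)" if "y < - exp (-1)" for y
  proof -
    have "(-1 \<le> w \<and> w * exp w = y) = False" for w
      using mult_exp_strict_mono[of "-1" w] that by (cases "w = -1") auto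
    then show ?thesis unfolding lambert_W_def by (simp only:)
  qed
  \<comment> \<open>Clamping the argument at -1/e gives a function that is monotone on the whole
    line, hence Borel.\<close>
  then have eq: "lambert_W = (\<lambda>y. if y < - exp (-1) then (THE w::real. False)
                              else lambert_W (max (- exp (-1)) y))"
    by (auto simp: max_def)
  have [measurable]: "(\<lambda>y. lambert_W (max (- exp (-1)) y)) \<in> borel_measurable borel"
    by (intro borel_measurable_mono monoI lambert_W_mono) auto
  show ?thesis by (subst eq) measurable
qed

subsection \<open>The subgradient property of the radial profile\<close>

lemma log_plus_nonneg: "0 \<le> log_plus r"
  by (simp add: log_plus_def)

lemma ln_le_log_plus: "0 < r \<Longrightarrow> ln r \<le> log_plus r"
  by (simp add: log_plus_def)

text \<open>The left side is the tangent at t of the convex function s ln(s/k), and replacing ln by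
  \<open>log_plus\<close> only raises the right side. After division by s the tangent inequality is
  ln u \<le> u - 1 at u = t/s.\<close>

lemma log_plus_tangent:
  assumes "0 < k" "0 < t" "0 \<le> s"
  shows "s * ln (t / k) + s - t \<le> s * log_plus (s / k)"
proof (cases "s = 0")
  case False
  then have s: "0 < s" using assms by simp
  have "s * ln (t / s) \<le> s * (t / s - 1)"
    using assms s by (intro mult_left_mono ln_le_minus_one) auto
  then have "s * ln (t / k) + s - t \<le> s * ln (s / k)"
    using assms s by (simp add: ln_div algebra_simps)
  also have "\<dots> \<le> s * log_plus (s / k)"
    using assms s by (intro mult_left_mono ln_le_log_plus) auto
  finally show ?thesis .
qed (use assms in auto)

lemma phi_ge:
  assumes "0 < \<alpha>" "0 < \<gamma>" "0 \<le> s"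
  shows "\<alpha> * s \<le> phi \<alpha> \<gamma> \<kappa> x s"
  using assms by (simp add: phi_def log_plus_nonneg algebra_simps)

text \<open>For t > \<kappa> x this is the tangent of \<open>phi\<close> at t. At t = \<kappa> x its
  slope is \<alpha>(1 + \<gamma>), the right derivative at the kink.\<close>

lemma phi_tangent:
  assumes "0 < \<alpha>" "0 < \<gamma>" "0 < \<kappa> x" "0 < t" "0 \<le> s"
  shows "\<alpha> * (1 + \<gamma> + \<gamma> * ln (t / \<kappa> x)) * s - \<alpha> * \<gamma> * t \<le> phi \<alpha> \<gamma> \<kappa> x s"
  using mult_left_mono[OF log_plus_tangent[of "\<kappa> x" t s], of "\<alpha> * \<gamma>"] assms
  by (simp add: phi_def algebra_simps)

text \<open>Beyond the kink, t must solve the stationarity equation r - \<sigma>t = \<alpha>(1 +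
  \<gamma> + \<gamma> ln(t/k)). With w = \<sigma>t/(\<alpha>\<gamma>), and b, c as in the proof,
  this reads w + ln(w/b) = c, that is, w exp w = b exp c, which W solves.\<close>

lemma rho_lambert_branch:
  assumes "0 < \<alpha>" "0 < \<gamma>" "0 < k" "0 < \<sigma>" "\<alpha> * (1 + \<gamma>) + \<sigma> * k < r"
  defines "w \<equiv> lambert_W (\<sigma> * k / (\<alpha> * \<gamma>) * exp ((r / \<alpha> - 1 - \<gamma>) / \<gamma>))"
  defines "t \<equiv> \<alpha> * \<gamma> * w / \<sigma>"
  shows "k < t" "r - \<alpha> * \<gamma> * w = \<alpha> * (1 + \<gamma> + \<gamma> * ln (t / k))"
proof -
  define b where "b = \<sigma> * k / (\<alpha> * \<gamma>)"
  define c where "c = (r / \<alpha> - 1 - \<gamma>) / \<gamma>"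
  have b: "0 < b" using assms by (simp add: b_def)
  \<comment> \<open>The threshold on r is exactly b < c. Hence w exp w = b exp c > b exp b, which
    forces w > b, and this is t > k.\<close>
  have bc: "b < c" using assms unfolding b_def c_def by (simp add: field_simps)
  have "- exp (-1) \<le> (0::real)" by simp
  also have "0 \<le> b * exp c" using b by simp
  finally have w: "-1 \<le> w" "w * exp w = b * exp c"
    unfolding w_def b_def c_def by (rule lambert_W)+
  have bw: "b < w"
  proof (rule ccontr)
    assume "\<not> b < w"
    then have "w * exp w \<le> b * exp b"
      using mult_exp_strict_mono[of w b] w b by (cases "w = b") auto
    moreover have "b * exp b < b * exp c" using b bc by simp
    ultimately show False using w by simp
  qed
  have tk: "t / k = w / b" using assms(1-4) by (simp add: t_def b_def field_simps)
  show "k < t" using bw assms(1-4) by (simp add: t_def b_def field_simps)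
  have "ln (w * exp w) = ln (b * exp c)" using w by simp
  then have ln_tk: "ln (t / k) = c - w" using b bw by (simp add: tk ln_mult ln_div)
  have "r = \<alpha> * (1 + \<gamma> + \<gamma> * c)" using assms(1-2) by (simp add: c_def field_simps)
  then show "r - \<alpha> * \<gamma> * w = \<alpha> * (1 + \<gamma> + \<gamma> * ln (t / k))"
    unfolding ln_tk by (simp add: algebra_simps)
qed

text \<open>The slope of \<open>phi\<close> is \<alpha> up to \<kappa> x, jumps there to \<alpha>(1
  + \<gamma>), and then grows logarithmically. In r = \<rho> + \<sigma>t the four branches
  correspond to t = 0, 0 < t \<le> \<kappa> x, t = \<kappa> x and t > \<kappa> x.\<close>

lemma rho_subgradient:
  assumes "0 < \<alpha>" "0 < \<gamma>" "0 < \<kappa> x" "0 < \<sigma>" "0 \<le> r"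
  defines "\<rho> \<equiv> rho \<alpha> \<gamma> \<kappa> \<sigma> x r"
  defines "t \<equiv> (r - \<rho>) / \<sigma>"
  shows "0 \<le> \<rho>" "\<rho> \<le> r"
    and "\<And>s. 0 \<le> s \<Longrightarrow> \<rho> * s - phi \<alpha> \<gamma> \<kappa> x s \<le> \<rho> * t - phi \<alpha> \<gamma> \<kappa> x t"
proof -
  consider (1) "r \<le> \<alpha>" | (2) "\<alpha> < r" "r \<le> \<alpha> + \<sigma> * \<kappa> x"
    | (3) "\<alpha> + \<sigma> * \<kappa> x < r" "r \<le> \<alpha> * (1 + \<gamma>) + \<sigma> * \<kappa> x"
    | (4) "\<alpha> * (1 + \<gamma>) + \<sigma> * \<kappa> x < r" by linarith
  then have "0 \<le> \<rho> \<and> \<rho> \<le> r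
    \<and> (\<forall>s\<ge>0. \<rho> * s - phi \<alpha> \<gamma> \<kappa> x s \<le> \<rho> * t - phi \<alpha> \<gamma> \<kappa> x t)"
  proof cases
    case 1
    then have \<rho>: "\<rho> = r" and t: "t = 0" using assms by (auto simp: rho_def t_def \<rho>_def)
    have "r * s - phi \<alpha> \<gamma> \<kappa> x s \<le> 0" if "0 \<le> s" for s
      using phi_ge[of \<alpha> \<gamma> s \<kappa> x] mult_right_mono[OF 1 that] assms that by simp
    then show ?thesis using assms 1 by (simp add: \<rho> t) (simp add: phi_def)
  next
    case 2
    then have \<rho>: "\<rho> = \<alpha>" by (auto simp: rho_def \<rho>_def)
    have "0 < t" "t \<le> \<kappa> x"
      using 2 assms(4) by (simp_all add: t_def \<rho> field_simps)
    then have "phi \<alpha> \<gamma> \<kappa> x t = \<alpha> * t"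
      using assms(3) by (simp add: phi_def log_plus_def)
    then show ?thesis using 2 assms phi_ge[of \<alpha> \<gamma> _ \<kappa> x] by (simp add: \<rho>)
  next
    case 3
    then have \<rho>: "\<rho> = r - \<sigma> * \<kappa> x"
      using mult_pos_pos[OF assms(4,3)] by (auto simp: rho_def \<rho>_def)
    then have t: "t = \<kappa> x" using assms(4) by (simp add: t_def)
    have \<rho>_bounds: "\<alpha> < \<rho>" "\<rho> \<le> \<alpha> * (1 + \<gamma>)" using 3 by (auto simp: \<rho>)
    \<comment> \<open>\<rho> lies between the one-sided slopes at the kink. Left of \<kappa> x the
      support line of slope \<alpha> gives the bound, right of it the tangent at \<kappa> x.\<close>
    have "\<rho> * s - phi \<alpha> \<gamma> \<kappa> x s \<le> (\<rho> - \<alpha>) * \<kappa> x" if s: "0 \<le> s" for s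
    proof (cases "s \<le> \<kappa> x")
      case True
      then have "(\<rho> - \<alpha>) * s \<le> (\<rho> - \<alpha>) * \<kappa> x" using \<rho>_bounds by (intro mult_left_mono) auto
      then show ?thesis using phi_ge[of \<alpha> \<gamma> s \<kappa> x] assms s by (simp add: algebra_simps)
    next
      case False
      then have "(\<alpha> * (1 + \<gamma>) - \<rho>) * \<kappa> x \<le> (\<alpha> * (1 + \<gamma>) - \<rho>) * s"
        using \<rho>_bounds by (intro mult_left_mono) auto
      then show ?thesis
        using phi_tangent[of \<alpha> \<gamma> \<kappa> x "\<kappa> x" s] assms s by (simp add: algebra_simps)
    qed
    moreover have "phi \<alpha> \<gamma> \<kappa> x t = \<alpha> * t" using assms(3) by (simp add: t phi_def log_plus_def)
    moreover have "\<rho> \<le> r" using mult_pos_pos[OF assms(4,3)] by (simp add: \<rho>)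
    ultimately show ?thesis using \<rho>_bounds assms(1) by (simp add: t algebra_simps)
  next
    case 4
    define w where "w = lambert_W (\<sigma> * \<kappa> x / (\<alpha> * \<gamma>) * exp ((r / \<alpha> - 1 - \<gamma>) / \<gamma>))"
    have "0 < \<sigma> * \<kappa> x" "0 < \<alpha> * \<gamma>" using assms by auto
    then have \<rho>: "\<rho> = r - \<alpha> * \<gamma> * w"
      using 4 unfolding \<rho>_def rho_def w_def by (auto simp: algebra_simps)
    then have t: "t = \<alpha> * \<gamma> * w / \<sigma>" by (simp add: t_def)
    have kt: "\<kappa> x < t" and \<rho>_eq: "\<rho> = \<alpha> * (1 + \<gamma> + \<gamma> * ln (t / \<kappa> x))"
      using rho_lambert_branch[OF assms(1-4) 4] unfolding \<rho> t w_def by auto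
    have t0: "0 < t" using kt assms(3) by simp
    have ln: "0 < ln (t / \<kappa> x)" using kt assms(3) by (intro ln_gt_zero) simp
    then have "phi \<alpha> \<gamma> \<kappa> x t = \<alpha> * t * (1 + \<gamma> * ln (t / \<kappa> x))"
      using t0 assms(3) by (simp add: phi_def log_plus_def)
    then have "\<rho> * t - phi \<alpha> \<gamma> \<kappa> x t = \<alpha> * \<gamma> * t"
      by (simp add: \<rho>_eq algebra_simps)
    \<comment> \<open>\<rho> is the slope of the tangent at t, whose intercept is
      -\<alpha>\<gamma>t; the supremum is therefore \<alpha>\<gamma>t.\<close>
    moreover have "\<rho> * s - phi \<alpha> \<gamma> \<kappa> x s \<le> \<alpha> * \<gamma> * t" if "0 \<le> s" for s
      using phi_tangent[of \<alpha> \<gamma> \<kappa> x t s] assms(1-3) t0 that by (simp add: \<rho>_eq)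
    moreover have "0 \<le> \<rho>" unfolding \<rho>_eq using assms(1,2) ln by simp
    moreover have "\<rho> \<le> r" using t0 assms(4) by (simp add: t_def field_simps)
    ultimately show ?thesis by simp
  qed
  then show "0 \<le> \<rho>" "\<rho> \<le> r"
    and "\<And>s. 0 \<le> s \<Longrightarrow> \<rho> * s - phi \<alpha> \<gamma> \<kappa> x s \<le> \<rho> * t - phi \<alpha> \<gamma> \<kappa> x t"
    by auto
qed

lemma phi_star_ge:
  "0 \<le> t \<Longrightarrow> ereal (s * t - phi \<alpha> \<gamma> \<kappa> x t) \<le> phi_star \<alpha> \<gamma> \<kappa> x s"
  unfolding phi_star_def by (rule SUP_upper) simp

lemma phi_star_eq:
  assumes "0 \<le> t" "\<And>u. 0 \<le> u \<Longrightarrow> s * u - phi \<alpha> \<gamma> \<kappa> x u \<le> s * t - phi \<alpha> \<gamma> \<kappa> x t"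
  shows "phi_star \<alpha> \<gamma> \<kappa> x s = ereal (s * t - phi \<alpha> \<gamma> \<kappa> x t)"
  using assms by (intro antisym phi_star_ge) (auto simp: phi_star_def intro!: SUP_least)

subsection \<open>The pointwise proximal inequality\<close>

text \<open>Expand the square of p - q around P. Since P - q is a nonpositive multiple of the
  direction e of q, the Cauchy-Schwarz bound p \<bullet> e \<le> norm p controls the cross term by
  norms alone.\<close>

lemma norm_radial_quadratic:
  fixes p q :: "'a::real_inner"
  assumes "0 \<le> m" "m \<le> norm q"
  defines "P \<equiv> m *\<^sub>R (q /\<^sub>R norm q)"
  shows "norm P = m"
    and "(norm (P - q))\<^sup>2 + (norm (p - P))\<^sup>2 \<le> (norm (p - q))\<^sup>2 + 2 * (norm q - m) * (norm p - m)"
proof -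
  show norm_P: "norm P = m" using assms by (cases "q = 0") (auto simp: P_def)
  define e where "e = q /\<^sub>R norm q"
  have q: "q = norm q *\<^sub>R e" by (cases "q = 0") (auto simp: e_def)
  have "p \<bullet> e \<le> norm p * norm e" by (rule norm_cauchy_schwarz)
  also have "\<dots> \<le> norm p * 1" by (intro mult_left_mono) (cases "q = 0", simp_all add: e_def)
  finally have pe: "p \<bullet> e \<le> norm p" by simp
  \<comment> \<open>If q = 0 then e is the zero vector rather than a unit vector, but m \<le> norm q
    then forces m = 0.\<close>
  have "m * (e \<bullet> e) = m"
    using assms(1,2) by (cases "q = 0") (simp_all add: e_def dot_square_norm)
  then have Pe: "P \<bullet> e = m" by (simp add: P_def e_def)
  have "(norm (p - q))\<^sup>2 = (norm (p - P))\<^sup>2 + (norm (P - q))\<^sup>2 + 2 * ((p - P) \<bullet> (P - q))"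
    by (simp add: power2_norm_eq_inner inner_diff inner_commute)
  also have "P - q = - (norm q - m) *\<^sub>R e"
    using q by (simp add: P_def e_def[symmetric] algebra_simps)
  then have "(p - P) \<bullet> (P - q) = - (norm q - m) * (p \<bullet> e - m)"
    by (simp add: inner_diff_left Pe)
  finally show "(norm (P - q))\<^sup>2 + (norm (p - P))\<^sup>2
      \<le> (norm (p - q))\<^sup>2 + 2 * (norm q - m) * (norm p - m)"
    using mult_left_mono[OF pe, of "norm q - m"] assms(2) by (simp add: algebra_simps)
qed

text \<open>No case distinction at q x = 0: scaling the zero vector already gives 0 there.\<close>

definition radial_prox ::
    "real \<Rightarrow> real \<Rightarrow> ('a \<Rightarrow> real) \<Rightarrow> real \<Rightarrow> ('a::euclidean_space \<Rightarrow> 'a) \<Rightarrow> 'a \<Rightarrow> 'a" where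
  "radial_prox \<alpha> \<gamma> \<kappa> \<sigma> q x = rho \<alpha> \<gamma> \<kappa> \<sigma> x (norm (q x)) *\<^sub>R (q x /\<^sub>R norm (q x))"

definition prox_integrand ::
    "real \<Rightarrow> real \<Rightarrow> ('a::euclidean_space \<Rightarrow> real) \<Rightarrow> real \<Rightarrow> ('a \<Rightarrow> 'a) \<Rightarrow> ('a \<Rightarrow> 'a) \<Rightarrow> 'a \<Rightarrow> ennreal" where
  "prox_integrand \<alpha> \<gamma> \<kappa> \<sigma> q p x =
     e2ennreal (ereal (1 / (2 * \<sigma>) * (norm (p x - q x))\<^sup>2) + phi_star \<alpha> \<gamma> \<kappa> x (norm (p x)))"

text \<open>The conjugate is replaced by its value at the maximiser t, so that the optimal integrand
  is real-valued and its measurability does not involve an uncountable supremum.\<close>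

definition radial_value ::
    "real \<Rightarrow> real \<Rightarrow> ('a::euclidean_space \<Rightarrow> real) \<Rightarrow> real \<Rightarrow> ('a \<Rightarrow> 'a) \<Rightarrow> 'a \<Rightarrow> real" where
  "radial_value \<alpha> \<gamma> \<kappa> \<sigma> q x =
     (let \<rho> = rho \<alpha> \<gamma> \<kappa> \<sigma> x (norm (q x)); t = (norm (q x) - \<rho>) / \<sigma>
      in 1 / (2 * \<sigma>) * (norm (radial_prox \<alpha> \<gamma> \<kappa> \<sigma> q x - q x))\<^sup>2 + (\<rho> * t - phi \<alpha> \<gamma> \<kappa> x t))"

lemma radial_prox_optimal:
  fixes p q :: "'a::euclidean_space \<Rightarrow> 'a"
  assumes "0 < \<alpha>" "0 < \<gamma>" "0 < \<kappa> x" "0 < \<sigma>"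
  defines "P \<equiv> radial_prox \<alpha> \<gamma> \<kappa> \<sigma> q"
  shows "norm (P x) \<le> norm (q x)"
    and "prox_integrand \<alpha> \<gamma> \<kappa> \<sigma> q P x = ennreal (radial_value \<alpha> \<gamma> \<kappa> \<sigma> q x)"
    and "ennreal (radial_value \<alpha> \<gamma> \<kappa> \<sigma> q x) + ennreal (1 / (2 * \<sigma>) * (norm (p x - P x))\<^sup>2)
           \<le> prox_integrand \<alpha> \<gamma> \<kappa> \<sigma> q p x"
proof -
  define \<rho> where "\<rho> = rho \<alpha> \<gamma> \<kappa> \<sigma> x (norm (q x))"
  define t where "t = (norm (q x) - \<rho>) / \<sigma>"
  note sub = rho_subgradient[where x = x and \<kappa> = \<kappa>, OF assms(1-4) norm_ge_zero[of "q x"], folded \<rho>_def, folded t_def]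
  note rad = norm_radial_quadratic[OF sub(1,2), folded \<rho>_def]
  have Px: "P x = \<rho> *\<^sub>R (q x /\<^sub>R norm (q x))" by (simp add: P_def radial_prox_def \<rho>_def)
  have nP: "norm (P x) = \<rho>" unfolding Px by (rule rad)
  then show "norm (P x) \<le> norm (q x)" using sub by simp
  have t0: "0 \<le> t" using sub assms by (simp add: t_def)
  have val: "radial_value \<alpha> \<gamma> \<kappa> \<sigma> q x
      = 1 / (2 * \<sigma>) * (norm (P x - q x))\<^sup>2 + (\<rho> * t - phi \<alpha> \<gamma> \<kappa> x t)"
    by (simp add: radial_value_def Let_def P_def \<rho>_def t_def)
  have star: "phi_star \<alpha> \<gamma> \<kappa> x \<rho> = ereal (\<rho> * t - phi \<alpha> \<gamma> \<kappa> x t)"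
    by (rule phi_star_eq) (use t0 sub(3) in auto)
  show "prox_integrand \<alpha> \<gamma> \<kappa> \<sigma> q P x = ennreal (radial_value \<alpha> \<gamma> \<kappa> \<sigma> q x)"
    by (simp add: prox_integrand_def val nP star)
  \<comment> \<open>Nonnegativity comes from testing with s = 0; it lets \<open>ennreal\<close>
    distribute over the final sum.\<close>
  have "0 \<le> \<rho> * t - phi \<alpha> \<gamma> \<kappa> x t" using sub(3)[of 0] by (simp add: phi_def)
  then have val0: "0 \<le> radial_value \<alpha> \<gamma> \<kappa> \<sigma> q x" using assms(4) by (simp add: val)
  have "1 / (2 * \<sigma>) * ((norm (P x - q x))\<^sup>2 + (norm (p x - P x))\<^sup>2)
      \<le> 1 / (2 * \<sigma>) * ((norm (p x - q x))\<^sup>2 + 2 * (norm (q x) - \<rho>) * (norm (p x) - \<rho>))"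
    using rad(2)[of "p x"] assms(4) unfolding Px by (intro mult_left_mono) auto
  \<comment> \<open>The cross term is t (norm (p x) - \<rho>). Added to \<rho>t - \<phi>(t) it
    leaves norm (p x) t - \<phi>(t), which is the test of the conjugate at norm (p x) with this
    t.\<close>
  moreover have "1 / (2 * \<sigma>) * (2 * (norm (q x) - \<rho>) * (norm (p x) - \<rho>)) = t * (norm (p x) - \<rho>)"
    using assms(4) by (simp add: t_def field_simps)
  ultimately have "radial_value \<alpha> \<gamma> \<kappa> \<sigma> q x + 1 / (2 * \<sigma>) * (norm (p x - P x))\<^sup>2
      \<le> 1 / (2 * \<sigma>) * (norm (p x - q x))\<^sup>2 + (norm (p x) * t - phi \<alpha> \<gamma> \<kappa> x t)"
    unfolding val distrib_left by (simp add: algebra_simps)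
  then have "ereal (radial_value \<alpha> \<gamma> \<kappa> \<sigma> q x + 1 / (2 * \<sigma>) * (norm (p x - P x))\<^sup>2)
      \<le> ereal (1 / (2 * \<sigma>) * (norm (p x - q x))\<^sup>2) + ereal (norm (p x) * t - phi \<alpha> \<gamma> \<kappa> x t)"
    by simp
  also have "\<dots> \<le> ereal (1 / (2 * \<sigma>) * (norm (p x - q x))\<^sup>2) + phi_star \<alpha> \<gamma> \<kappa> x (norm (p x))"
    by (intro add_left_mono phi_star_ge t0)
  finally have "ennreal (radial_value \<alpha> \<gamma> \<kappa> \<sigma> q x + 1 / (2 * \<sigma>) * (norm (p x - P x))\<^sup>2)
      \<le> prox_integrand \<alpha> \<gamma> \<kappa> \<sigma> q p x"
    unfolding prox_integrand_def by (metis e2ennreal_ereal e2ennreal_mono)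
  then show "ennreal (radial_value \<alpha> \<gamma> \<kappa> \<sigma> q x) + ennreal (1 / (2 * \<sigma>) * (norm (p x - P x))\<^sup>2)
      \<le> prox_integrand \<alpha> \<gamma> \<kappa> \<sigma> q p x"
    using val0 assms(4) by (simp add: ennreal_plus[symmetric] del: ennreal_plus)
qed

subsection \<open>Integration\<close>

lemma borel_measurable_log_plus [measurable]: "log_plus \<in> borel_measurable borel"
  unfolding log_plus_def[abs_def] by measurable

lemma borel_measurable_rho:
  assumes [measurable]: "\<kappa> \<in> borel_measurable M" "r \<in> borel_measurable M"
  shows "(\<lambda>x. rho \<alpha> \<gamma> \<kappa> \<sigma> x (r x)) \<in> borel_measurable M"
  unfolding rho_def by measurable

lemma borel_measurable_radial_prox:
  assumes [measurable]: "\<kappa> \<in> borel_measurable M" "q \<in> borel_measurable M"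
  shows "radial_prox \<alpha> \<gamma> \<kappa> \<sigma> q \<in> borel_measurable M"
proof -
  have [measurable]: "(\<lambda>x. rho \<alpha> \<gamma> \<kappa> \<sigma> x (norm (q x))) \<in> borel_measurable M"
    by (rule borel_measurable_rho) measurable
  show ?thesis unfolding radial_prox_def[abs_def] by measurable
qed

lemma borel_measurable_radial_value:
  assumes [measurable]: "\<kappa> \<in> borel_measurable M" "q \<in> borel_measurable M"
  shows "radial_value \<alpha> \<gamma> \<kappa> \<sigma> q \<in> borel_measurable M"
proof -
  have [measurable]: "(\<lambda>x. rho \<alpha> \<gamma> \<kappa> \<sigma> x (norm (q x))) \<in> borel_measurable M"
    by (rule borel_measurable_rho) measurable
  have [measurable]: "radial_prox \<alpha> \<gamma> \<kappa> \<sigma> q \<in> borel_measurable M"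
    by (rule borel_measurable_radial_prox) measurable
  show ?thesis unfolding radial_value_def[abs_def] Let_def phi_def by measurable
qed

lemma prox_objective_eq:
  "prox_objective \<alpha> \<gamma> \<kappa> \<Omega> \<sigma> q p = (\<integral>\<^sup>+ x. prox_integrand \<alpha> \<gamma> \<kappa> \<sigma> q p x \<partial>lebesgue_on \<Omega>)"
  by (simp add: prox_objective_def prox_integrand_def)

lemma prox_G_star_radial_prox:
  fixes \<Omega> :: "('a::euclidean_space) set"
  assumes "0 < \<alpha>" "0 < \<gamma>" "0 < \<sigma>"
    and \<kappa> [measurable]: "\<kappa> \<in> borel_measurable (lebesgue_on \<Omega>)"
    and pos: "AE x in lebesgue_on \<Omega>. 0 < \<kappa> x"
    and q: "q \<in> L2_fields \<Omega>"
  defines "P \<equiv> radial_prox \<alpha> \<gamma> \<kappa> \<sigma> q"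
  shows "P \<in> prox_G_star \<alpha> \<gamma> \<kappa> \<Omega> \<sigma> q"
    and "p \<in> prox_G_star \<alpha> \<gamma> \<kappa> \<Omega> \<sigma> q \<Longrightarrow> AE x in lebesgue_on \<Omega>. p x = P x"
proof -
  let ?M = "lebesgue_on \<Omega>"
  let ?d = "\<lambda>p x. ennreal (1 / (2 * \<sigma>) * (norm (p x - P x))\<^sup>2)"
  let ?J = "prox_objective \<alpha> \<gamma> \<kappa> \<Omega> \<sigma> q"
  have [measurable]: "q \<in> borel_measurable ?M"
    and int_q: "integrable ?M (\<lambda>x. (norm (q x))\<^sup>2)"
    using q by (auto simp: L2_fields_def)
  have [measurable]: "P \<in> borel_measurable ?M"
    unfolding P_def by (intro borel_measurable_radial_prox) measurable
  have [measurable]: "radial_value \<alpha> \<gamma> \<kappa> \<sigma> q \<in> borel_measurable ?M"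
    by (intro borel_measurable_radial_value) measurable
  note opt = radial_prox_optimal[OF assms(1,2) _ assms(3), of \<kappa> _ q, folded P_def]
  have "AE x in ?M. norm ((norm (P x))\<^sup>2) \<le> norm ((norm (q x))\<^sup>2)"
    using pos by eventually_elim (auto intro!: power_mono opt(1))
  then have P_L2: "P \<in> L2_fields \<Omega>"
    unfolding L2_fields_def by (auto intro!: Bochner_Integration.integrable_bound[OF int_q])
  have JP: "?J P = (\<integral>\<^sup>+ x. ennreal (radial_value \<alpha> \<gamma> \<kappa> \<sigma> q x) \<partial>?M)"
    unfolding prox_objective_eq
    using pos by (intro nn_integral_cong_AE) (auto elim!: eventually_mono simp: opt(2))
  \<comment> \<open>The integral is split only on the side where both summands are known to be
    measurable; the passage to \<open>prox_integrand\<close> uses monotonicity alone.\<close>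
  have gap: "?J P + (\<integral>\<^sup>+ x. ?d p x \<partial>?M) \<le> ?J p" if "p \<in> L2_fields \<Omega>" for p
  proof -
    have [measurable]: "p \<in> borel_measurable ?M" using that by (simp add: L2_fields_def)
    have "?J P + (\<integral>\<^sup>+ x. ?d p x \<partial>?M)
        = (\<integral>\<^sup>+ x. ennreal (radial_value \<alpha> \<gamma> \<kappa> \<sigma> q x) + ?d p x \<partial>?M)"
      unfolding JP by (intro nn_integral_add[symmetric]) measurable
    also have "\<dots> \<le> ?J p"
      unfolding prox_objective_eq
      using pos by (intro nn_integral_mono_AE) (rule eventually_mono, assumption, rule opt(3))
    finally show ?thesis .
  qed
  then have min: "?J P \<le> ?J p" if "p \<in> L2_fields \<Omega>" for p
    using that by (meson add_increasing2 order_refl order_trans zero_le)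
  with P_L2 show P: "P \<in> prox_G_star \<alpha> \<gamma> \<kappa> \<Omega> \<sigma> q" by (auto simp: prox_G_star_def)
  have "phi_star \<alpha> \<gamma> \<kappa> x 0 = 0" for x
  proof -
    have "phi \<alpha> \<gamma> \<kappa> x 0 \<le> phi \<alpha> \<gamma> \<kappa> x u" if "0 \<le> u" for u
      using assms(1,2) that by (simp add: phi_def log_plus_nonneg)
    then have "phi_star \<alpha> \<gamma> \<kappa> x 0 = ereal (0 * 0 - phi \<alpha> \<gamma> \<kappa> x 0)"
      by (intro phi_star_eq) auto
    then show ?thesis by (simp add: phi_def)
  qed
  then have "?J (\<lambda>x. 0) = (\<integral>\<^sup>+ x. ennreal (1 / (2 * \<sigma>) * (norm (q x))\<^sup>2) \<partial>?M)"
    unfolding prox_objective_def by (simp add: e2ennreal_ereal)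
  also have "\<dots> < \<infinity>"
    using integrable_mult_right[OF int_q, of "1 / (2 * \<sigma>)"] assms(3)
    by (subst nn_integral_eq_integral) auto
  finally have "?J P < \<infinity>"
    using min[of "\<lambda>x. 0"] by (auto simp: L2_fields_def intro: le_less_trans)
  show "AE x in ?M. p x = P x" if p: "p \<in> prox_G_star \<alpha> \<gamma> \<kappa> \<Omega> \<sigma> q"
  proof -
    have p_L2: "p \<in> L2_fields \<Omega>" and "?J p \<le> ?J P"
      using p P_L2 by (auto simp: prox_G_star_def)
    then have "?J P + (\<integral>\<^sup>+ x. ?d p x \<partial>?M) \<le> ?J P + 0"
      using order_trans[OF gap[OF p_L2], of "?J P"] by (simp only: add_0_right)
    \<comment> \<open>Cancelling \<open>?J P\<close> in the extended nonnegative reals is legitimate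
      because it is finite.\<close>
    then have "(\<integral>\<^sup>+ x. ?d p x \<partial>?M) = 0"
      using \<open>?J P < \<infinity>\<close> by (subst (asm) ennreal_add_left_cancel_le) auto
    moreover have [measurable]: "p \<in> borel_measurable ?M" using p_L2 by (simp add: L2_fields_def)
    ultimately have "AE x in ?M. ?d p x = 0"
      by (subst (asm) nn_integral_0_iff_AE) auto
    then show ?thesis
      using assms(3) by (auto elim!: eventually_mono simp: ennreal_eq_0_iff divide_le_0_iff)
  qed
qed

theorem lemma4p8:
  fixes \<Omega> :: "(real ^ 'n) set"
    and \<kappa> :: "real ^ 'n \<Rightarrow> real"
    and \<alpha> \<gamma> \<kappa>_minus \<kappa>_plus \<sigma> :: real
    and q :: "real ^ 'n \<Rightarrow> real ^ 'n"
  assumes "bounded_lipschitz_domain \<Omega>"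
    and "\<alpha> > 0" and "\<gamma> > 0"
    and "\<kappa> \<in> borel_measurable (lebesgue_on \<Omega>)"
    and "0 < \<kappa>_minus"
    and "AE x in lebesgue_on \<Omega>. \<kappa>_minus \<le> \<kappa> x \<and> \<kappa> x \<le> \<kappa>_plus"
    and "\<sigma> > 0"
    and "q \<in> L2_fields \<Omega>"
  shows "(\<lambda>x. if q x = 0 then 0
              else rho \<alpha> \<gamma> \<kappa> \<sigma> x (norm (q x)) *\<^sub>R (q x /\<^sub>R norm (q x)))
           \<in> prox_G_star \<alpha> \<gamma> \<kappa> \<Omega> \<sigma> q
       \<and> (\<forall>p \<in> prox_G_star \<alpha> \<gamma> \<kappa> \<Omega> \<sigma> q. AE x in lebesgue_on \<Omega>.
             p x = (if q x = 0 then 0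
                    else rho \<alpha> \<gamma> \<kappa> \<sigma> x (norm (q x)) *\<^sub>R (q x /\<^sub>R norm (q x))))"
proof -
  have eq: "(\<lambda>x. if q x = 0 then 0
              else rho \<alpha> \<gamma> \<kappa> \<sigma> x (norm (q x)) *\<^sub>R (q x /\<^sub>R norm (q x))) = radial_prox \<alpha> \<gamma> \<kappa> \<sigma> q"
    by (auto simp: radial_prox_def)
  have "AE x in lebesgue_on \<Omega>. 0 < \<kappa> x"
    using assms(6) by eventually_elim (use assms(5) in auto)
  note prox = prox_G_star_radial_prox[OF assms(2,3,7,4) this assms(8)]
  show ?thesis
    using prox unfolding eq[symmetric] by blast
qed

end
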